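(* Let $E$ be a Hilbert space with norm $\|\cdot\|$, let $D$ be a self-adjoint positive definite operator in $E$, let $\omega>0$, and let $f\in E$. The following conditions are equivalent: (a) $f$ belongs to $PW_{\omega}(D)$; (b) $f$ satisfies the Bernstein inequality: $f$ belongs to the domain of $D^{k}$ and $$\|D^{k}f\|\le \omega^{k}\|f\|$$ for every natural number $k$.
   Context: Positive definite means $\langle Df,f\rangle\ge 0$ for $f$ in the domain of $D$, so the spectrum of $D$ lies in $[0,\infty)$. By the spectral theorem there exist a direct integral of Hilbert spaces $X=\int X(\lambda)\,dm(\lambda)$ over $[0,\infty)$, whose elements are the $m$-measurable functions $\lambda\mapsto x(\lambda)\in X(\lambda)$ with finite norm $\|x\|_{X}=\left(\int_{0}^{\infty}\|x(\lambda)\|_{X(\lambda)}^{2}\,dm(\lambda)\right)^{1/2}$, and a unitary operator $F$ from $E$ onto $X$ which transforms the domain of $D^{k}$ onto $X^{k}=\{x\in X:\lambda^{k}x\in X\}$, with norm $\|x\|_{X^k}=\left(\int_0^\infty \lambda^{2k}\|x(\lambda)\|^2_{X(\lambda)}\,dm(\lambda)\right)^{1/2}$, and satisfies $F(D^{k}f)=\lambda^{k}(Ff)$ for $f$ in the domain of $D^{k}$. A vector $f\in E$ belongs to $PW_{\omega}(D)$ if its "Fourier transform" $Ff$ has support in $[0,\omega]$, i.e. $(Ff)(\lambda)=0$ for $m$-almost every $\lambda>\omega$. *)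

theory Defs
  imports "HOL-Analysis.Analysis"
begin

text \<open>
  Complex inner product spaces, linear in the first argument. The axiom relating the norm to the
  inner product makes the form positive definite (\<open>sqrt\<close> is negative on negative reals).
\<close>

class complex_inner = real_normed_vector +
  fixes scaleC :: "complex \<Rightarrow> 'a \<Rightarrow> 'a"  (infixr "*\<^sub>C" 75)
    and cinner :: "'a \<Rightarrow> 'a \<Rightarrow> complex"
  assumes scaleR_scaleC: "scaleR r x = complex_of_real r *\<^sub>C x"
    and scaleC_add_right: "a *\<^sub>C (x + y) = a *\<^sub>C x + a *\<^sub>C y"
    and scaleC_add_left: "(a + b) *\<^sub>C x = a *\<^sub>C x + b *\<^sub>C x"
    and scaleC_scaleC: "a *\<^sub>C b *\<^sub>C x = (a * b) *\<^sub>C x"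
    and scaleC_one: "1 *\<^sub>C x = x"
    and cinner_commute: "cinner x y = cnj (cinner y x)"
    and cinner_add_left: "cinner (x + y) z = cinner x z + cinner y z"
    and cinner_scaleC_left: "cinner (a *\<^sub>C x) y = a * cinner x y"
    and norm_eq_sqrt_cinner: "norm x = sqrt (Re (cinner x x))"

class complex_hilbert = complex_inner + complete_space

instantiation complex :: complex_hilbert
begin

definition scaleC_complex :: "complex \<Rightarrow> complex \<Rightarrow> complex"
  where "scaleC_complex a x = a * x"

definition cinner_complex :: "complex \<Rightarrow> complex \<Rightarrow> complex"
  where "cinner_complex x y = x * cnj y"

instance
proof
  fix x :: complex
  show "norm x = sqrt (Re (cinner x x))"
    by (simp add: cinner_complex_def cmod_def power2_eq_square)
qed (auto simp: scaleC_complex_def cinner_complex_def algebra_simps scaleR_conv_of_real)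

end

definition complex_subspace :: "'a::complex_inner set \<Rightarrow> bool" where
  "complex_subspace S \<longleftrightarrow>
     0 \<in> S \<and> (\<forall>x\<in>S. \<forall>y\<in>S. x + y \<in> S) \<and> (\<forall>c. \<forall>x\<in>S. c *\<^sub>C x \<in> S)"

text \<open>
  An unbounded operator is given by its domain \<open>A\<close> and a function \<open>D\<close> whose values outside \<open>A\<close>
  are irrelevant.
\<close>

definition linear_operator :: "'a::complex_inner set \<Rightarrow> ('a \<Rightarrow> 'a) \<Rightarrow> bool" where
  "linear_operator A D \<longleftrightarrow> complex_subspace A \<and>
     (\<forall>x\<in>A. \<forall>y\<in>A. D (x + y) = D x + D y) \<and> (\<forall>c. \<forall>x\<in>A. D (c *\<^sub>C x) = c *\<^sub>C D x)"

definition operator_graph :: "'a set \<Rightarrow> ('a \<Rightarrow> 'a) \<Rightarrow> ('a \<times> 'a) set" where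
  "operator_graph A D = {(f, D f) | f. f \<in> A}"

definition adjoint_graph :: "'a::complex_inner set \<Rightarrow> ('a \<Rightarrow> 'a) \<Rightarrow> ('a \<times> 'a) set" where
  "adjoint_graph A D = {(g, h). \<forall>f\<in>A. cinner (D f) g = cinner f h}"

definition self_adjoint :: "'a::complex_inner set \<Rightarrow> ('a \<Rightarrow> 'a) \<Rightarrow> bool" where
  "self_adjoint A D \<longleftrightarrow>
     linear_operator A D \<and> closure A = UNIV \<and> adjoint_graph A D = operator_graph A D"

text \<open>For self-adjoint \<open>D\<close> the number \<open>cinner (D f) f\<close> is real.\<close>

definition positive_operator :: "'a::complex_inner set \<Rightarrow> ('a \<Rightarrow> 'a) \<Rightarrow> bool" where
  "positive_operator A D \<longleftrightarrow> (\<forall>f\<in>A. 0 \<le> Re (cinner (D f) f))"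

text \<open>The domain of the power \<open>D ^^ k\<close>.\<close>

primrec power_domain :: "'a set \<Rightarrow> ('a \<Rightarrow> 'a) \<Rightarrow> nat \<Rightarrow> 'a set" where
  "power_domain A D 0 = UNIV"
| "power_domain A D (Suc k) = {f \<in> power_domain A D k. (D ^^ k) f \<in> A}"

text \<open>
  A measurable field of Hilbert spaces over \<open>m\<close>. The fibres \<open>X t\<close> are closed subspaces of one
  ambient Hilbert space; this is no restriction, since any family of Hilbert spaces embeds
  isometrically into its Hilbert sum. The ambient space plays no role for measurability, which is
  given by the space \<open>\<Gamma>\<close> of measurable sections: their norms are measurable functions, and \<open>\<Gamma>\<close>
  contains every section whose inner products with all members of \<open>\<Gamma>\<close> are measurable. The
  customary further requirement of a fundamental sequence of measurable sections is not imposed,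
  so the fibres may be non-separable.
\<close>

definition measurable_field ::
    "real measure \<Rightarrow> (real \<Rightarrow> 'h::complex_hilbert set) \<Rightarrow> (real \<Rightarrow> 'h) set \<Rightarrow> bool" where
  "measurable_field m X \<Gamma> \<longleftrightarrow>
     (\<forall>t\<in>space m. complex_subspace (X t) \<and> closed (X t)) \<and>
     (\<forall>x\<in>\<Gamma>. \<forall>t\<in>space m. x t \<in> X t) \<and>
     (\<lambda>t. 0) \<in> \<Gamma> \<and>
     (\<forall>x\<in>\<Gamma>. \<forall>y\<in>\<Gamma>. (\<lambda>t. x t + y t) \<in> \<Gamma>) \<and>
     (\<forall>c. \<forall>x\<in>\<Gamma>. (\<lambda>t. c *\<^sub>C x t) \<in> \<Gamma>) \<and>
     (\<forall>x\<in>\<Gamma>. (\<lambda>t. norm (x t)) \<in> borel_measurable m) \<and>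
     (\<forall>y. (\<forall>t\<in>space m. y t \<in> X t) \<and>
          (\<forall>x\<in>\<Gamma>. (\<lambda>t. cinner (x t) (y t)) \<in> borel_measurable m) \<longrightarrow> y \<in> \<Gamma>)"

text \<open>
  The direct integral, represented by square integrable measurable sections; two sections stand
  for the same element if they agree almost everywhere.
\<close>

definition direct_integral :: "real measure \<Rightarrow> (real \<Rightarrow> 'h::complex_hilbert) set \<Rightarrow> (real \<Rightarrow> 'h) set" where
  "direct_integral m \<Gamma> = {x \<in> \<Gamma>. integrable m (\<lambda>t. (norm (x t))\<^sup>2)}"

definition direct_integral_norm :: "real measure \<Rightarrow> (real \<Rightarrow> 'h::complex_hilbert) \<Rightarrow> real" where
  "direct_integral_norm m x = sqrt (\<integral>t. (norm (x t))\<^sup>2 \<partial>m)"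

definition direct_integral_power ::
    "real measure \<Rightarrow> (real \<Rightarrow> 'h::complex_hilbert) set \<Rightarrow> nat \<Rightarrow> (real \<Rightarrow> 'h) set" where
  "direct_integral_power m \<Gamma> k =
     {x \<in> direct_integral m \<Gamma>. (\<lambda>t. t ^ k *\<^sub>R x t) \<in> direct_integral m \<Gamma>}"

definition unitary_onto_direct_integral ::
    "real measure \<Rightarrow> (real \<Rightarrow> 'h::complex_hilbert) set \<Rightarrow> ('e::complex_hilbert \<Rightarrow> real \<Rightarrow> 'h) \<Rightarrow> bool" where
  "unitary_onto_direct_integral m \<Gamma> F \<longleftrightarrow>
     (\<forall>f. F f \<in> direct_integral m \<Gamma>) \<and>
     (\<forall>f g. AE t in m. F (f + g) t = F f t + F g t) \<and>
     (\<forall>c f. AE t in m. F (c *\<^sub>C f) t = c *\<^sub>C F f t) \<and>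
     (\<forall>f. direct_integral_norm m (F f) = norm f) \<and>
     (\<forall>x\<in>direct_integral m \<Gamma>. \<exists>f. AE t in m. F f t = x t)"

text \<open>
  The data provided by the spectral theorem for a positive self-adjoint operator \<open>D\<close>. The measure
  \<open>m\<close> lives on \<open>[0,\<infinity>)\<close> and is defined at least on its Borel sets (possibly on a completion).
\<close>

definition spectral_representation ::
    "'e::complex_hilbert set \<Rightarrow> ('e \<Rightarrow> 'e) \<Rightarrow> real measure \<Rightarrow> (real \<Rightarrow> 'h::complex_hilbert set) \<Rightarrow>
     (real \<Rightarrow> 'h) set \<Rightarrow> ('e \<Rightarrow> real \<Rightarrow> 'h) \<Rightarrow> bool" where
  "spectral_representation A D m X \<Gamma> F \<longleftrightarrow>
     space m = {0..} \<and> sets (restrict_space borel {0..}) \<subseteq> sets m \<and>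
     measurable_field m X \<Gamma> \<and>
     unitary_onto_direct_integral m \<Gamma> F \<and>
     (\<forall>k. \<forall>f\<in>power_domain A D k. F f \<in> direct_integral_power m \<Gamma> k) \<and>
     (\<forall>k. \<forall>x\<in>direct_integral_power m \<Gamma> k. \<exists>f\<in>power_domain A D k. AE t in m. F f t = x t) \<and>
     (\<forall>k. \<forall>f\<in>power_domain A D k. AE t in m. F ((D ^^ k) f) t = t ^ k *\<^sub>R F f t)"

definition paley_wiener :: "real measure \<Rightarrow> ('e \<Rightarrow> real \<Rightarrow> 'h::complex_hilbert) \<Rightarrow> real \<Rightarrow> 'e set" where
  "paley_wiener m F \<omega> = {f. AE t in m. t > \<omega> \<longrightarrow> F f t = 0}"

end

theory Submission
  imports Defs
begin

text \<open>
  In the spectral representation \<open>\<parallel>D\<^sup>k f\<parallel>\<^sup>2 = \<integral> t\<^sup>2\<^sup>k \<parallel>F f t\<parallel>\<^sup>2 dm\<close>. If \<open>F f\<close> is supported in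
  \<open>[0, \<omega>]\<close>, the weight is at most \<open>\<omega>\<^sup>2\<^sup>k\<close> on the support. Conversely, for \<open>c > \<omega>\<close> the
  Bernstein inequality bounds the mass of \<open>F f\<close> on \<open>[c, \<infinity>)\<close> by \<open>(\<omega> / c)\<^sup>2\<^sup>k \<parallel>f\<parallel>\<^sup>2\<close> for every
  \<open>k\<close>, so this mass vanishes.
\<close>

section \<open>Inner products recovered from norms\<close>

lemma cinner_add_right: "cinner x (y + z) = cinner x y + cinner x z"
  by (metis cinner_add_left cinner_commute complex_cnj_add)

lemma cinner_scaleC_right: "cinner x (a *\<^sub>C y) = cnj a * cinner x y"
  by (metis cinner_scaleC_left cinner_commute complex_cnj_mult)

text \<open>Since \<open>sqrt\<close> takes negative values on negative reals, squaring
  \<open>norm_eq_sqrt_cinner\<close> is legitimate only because nonnegativity of the norm forces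
  \<open>Re (cinner x x)\<close> to be nonnegative.\<close>

lemma Re_cinner_self: "Re (cinner x x) = (norm x)\<^sup>2"
  by (metis norm_eq_sqrt_cinner norm_ge_zero real_sqrt_ge_0_iff real_sqrt_pow2)

lemma Re_cinner_polarization:
  "Re (cinner x y) = ((norm (x + y))\<^sup>2 - (norm x)\<^sup>2 - (norm y)\<^sup>2) / 2"
proof -
  have "Re (cinner y x) = Re (cinner x y)"
    by (subst cinner_commute) simp
  then show ?thesis
    by (simp add: cinner_add_left cinner_add_right flip: Re_cinner_self)
qed

lemma Im_cinner_eq_Re: "Im (cinner x y) = Re (cinner x (\<i> *\<^sub>C y))"
  by (simp add: cinner_scaleC_right)

section \<open>Measurable sections\<close>

lemma measurable_fieldD:
  assumes "measurable_field m X \<Gamma>"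
  shows "t \<in> space m \<Longrightarrow> complex_subspace (X t)"
    and "x \<in> \<Gamma> \<Longrightarrow> t \<in> space m \<Longrightarrow> x t \<in> X t"
    and "x \<in> \<Gamma> \<Longrightarrow> y \<in> \<Gamma> \<Longrightarrow> (\<lambda>t. x t + y t) \<in> \<Gamma>"
    and "x \<in> \<Gamma> \<Longrightarrow> (\<lambda>t. c *\<^sub>C x t) \<in> \<Gamma>"
    and "x \<in> \<Gamma> \<Longrightarrow> (\<lambda>t. norm (x t)) \<in> borel_measurable m"
proof -
  have "\<forall>t\<in>space m. complex_subspace (X t) \<and> closed (X t)"
    and "\<forall>x\<in>\<Gamma>. \<forall>t\<in>space m. x t \<in> X t"
    and "\<forall>x\<in>\<Gamma>. \<forall>y\<in>\<Gamma>. (\<lambda>t. x t + y t) \<in> \<Gamma>"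
    and "\<forall>c. \<forall>x\<in>\<Gamma>. (\<lambda>t. c *\<^sub>C x t) \<in> \<Gamma>"
    and "\<forall>x\<in>\<Gamma>. (\<lambda>t. norm (x t)) \<in> borel_measurable m"
    using assms unfolding measurable_field_def by - (elim conjE, assumption)+
  then show "t \<in> space m \<Longrightarrow> complex_subspace (X t)"
    and "x \<in> \<Gamma> \<Longrightarrow> t \<in> space m \<Longrightarrow> x t \<in> X t"
    and "x \<in> \<Gamma> \<Longrightarrow> y \<in> \<Gamma> \<Longrightarrow> (\<lambda>t. x t + y t) \<in> \<Gamma>"
    and "x \<in> \<Gamma> \<Longrightarrow> (\<lambda>t. c *\<^sub>C x t) \<in> \<Gamma>"
    and "x \<in> \<Gamma> \<Longrightarrow> (\<lambda>t. norm (x t)) \<in> borel_measurable m"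
    by blast+
qed

text \<open>A measurable field guarantees measurability of norms only. Polarization writes the real
  part through the norms of \<open>x\<close>, \<open>z\<close> and \<open>x + z\<close>, all
  sections in \<open>\<Gamma>\<close>; the imaginary part is the real part against
  \<open>\<i> *\<^sub>C y\<close>, again in \<open>\<Gamma>\<close>.\<close>

lemma measurable_field_cinner:
  assumes field: "measurable_field m X \<Gamma>" and "x \<in> \<Gamma>" "y \<in> \<Gamma>"
  shows "(\<lambda>t. cinner (x t) (y t)) \<in> borel_measurable m"
proof -
  have Re: "(\<lambda>t. Re (cinner (x t) (z t))) \<in> borel_measurable m" if "z \<in> \<Gamma>" for z
  proof -
    have "(\<lambda>t. norm (x t + z t)) \<in> borel_measurable m"
      by (rule measurable_fieldD(5)[OF field measurable_fieldD(3)[OF field \<open>x \<in> \<Gamma>\<close> that]])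
    with measurable_fieldD(5)[OF field \<open>x \<in> \<Gamma>\<close>] measurable_fieldD(5)[OF field that] show ?thesis
      unfolding Re_cinner_polarization
      by (intro borel_measurable_divide borel_measurable_diff borel_measurable_power
          borel_measurable_const)
  qed
  have "(\<lambda>t. Im (cinner (x t) (y t))) \<in> borel_measurable m"
    unfolding Im_cinner_eq_Re by (rule Re[OF measurable_fieldD(4)[OF field \<open>y \<in> \<Gamma>\<close>]])
  with Re[OF \<open>y \<in> \<Gamma>\<close>] show ?thesis
    by (subst borel_measurable_complex_iff) (rule conjI)
qed

lemma measurable_fieldI:
  assumes "measurable_field m X \<Gamma>" and "\<And>t. t \<in> space m \<Longrightarrow> y t \<in> X t"
    and "\<And>x. x \<in> \<Gamma> \<Longrightarrow> (\<lambda>t. cinner (x t) (y t)) \<in> borel_measurable m"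
  shows "y \<in> \<Gamma>"
proof -
  have "\<forall>y. (\<forall>t\<in>space m. y t \<in> X t) \<and>
      (\<forall>x\<in>\<Gamma>. (\<lambda>t. cinner (x t) (y t)) \<in> borel_measurable m) \<longrightarrow> y \<in> \<Gamma>"
    using assms(1) unfolding measurable_field_def by (elim conjE)
  from this[THEN spec, of y] assms(2,3) show ?thesis
    by simp
qed

text \<open>Makes the multiplication operator by \<open>t ^ k\<close> available on sections. By the
  maximality of \<open>\<Gamma>\<close> it suffices to test against its members, where the inner
  product is a measurable scalar times a measurable one.\<close>

lemma measurable_field_scaleR:
  assumes field: "measurable_field m X \<Gamma>" and "x \<in> \<Gamma>"
    and r: "r \<in> borel_measurable m"
  shows "(\<lambda>t. r t *\<^sub>R x t) \<in> \<Gamma>"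
proof (rule measurable_fieldI[OF field])
  show "r t *\<^sub>R x t \<in> X t" if "t \<in> space m" for t
    using measurable_fieldD(1)[OF field that] measurable_fieldD(2)[OF field \<open>x \<in> \<Gamma>\<close> that]
    by (simp add: complex_subspace_def scaleR_scaleC)
next
  show "(\<lambda>t. cinner (z t) (r t *\<^sub>R x t)) \<in> borel_measurable m" if "z \<in> \<Gamma>" for z
    using measurable_field_cinner[OF field that \<open>x \<in> \<Gamma>\<close>] r
    by (simp add: scaleR_scaleC cinner_scaleC_right)
qed

lemma scaleC_minus_one: "(-1) *\<^sub>C x = - x"
  using scaleR_scaleC[of "-1" x] by simp

lemma unitary_onto_direct_integralD:
  assumes "unitary_onto_direct_integral m \<Gamma> F"
  shows "F f \<in> direct_integral m \<Gamma>"
    and "AE t in m. F (f + g) t = F f t + F g t"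
    and "AE t in m. F (c *\<^sub>C f) t = c *\<^sub>C F f t"
    and "direct_integral_norm m (F f) = norm f"
  using assms unfolding unitary_onto_direct_integral_def by simp_all

text \<open>Norm preservation applied to \<open>f - g\<close>. Surjectivity onto the direct integral
  is stated only up to null sets, so this injectivity is what identifies a preimage.\<close>

lemma unitary_onto_direct_integral_eqI:
  assumes F: "unitary_onto_direct_integral m \<Gamma> F"
    and eq: "AE t in m. F f t = F g t"
  shows "f = g"
proof -
  have zero: "AE t in m. F (f - g) t = 0"
    using unitary_onto_direct_integralD(2)[OF F, of f "(-1) *\<^sub>C g"]
      unitary_onto_direct_integralD(3)[OF F, of "-1" g] eq
    by eventually_elim (simp add: scaleC_minus_one)
  have "(\<integral>t. (norm (F (f - g) t))\<^sup>2 \<partial>m) = (\<integral>t. 0 \<partial>m)"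
  proof (rule integral_cong_AE)
    show "(\<lambda>t. (norm (F (f - g) t))\<^sup>2) \<in> borel_measurable m"
      using unitary_onto_direct_integralD(1)[OF F, of "f - g"]
      by (simp add: direct_integral_def borel_measurable_integrable)
    show "AE t in m. (norm (F (f - g) t))\<^sup>2 = 0"
      using zero by eventually_elim simp
  qed simp
  then show ?thesis
    using unitary_onto_direct_integralD(4)[OF F, of "f - g"]
    by (simp add: direct_integral_norm_def)
qed

section \<open>Vanishing of a density beyond \<open>\<omega>\<close>, from its even moments\<close>

lemma AE_zero_of_moment_bound:
  fixes u :: "real \<Rightarrow> real"
  assumes "\<omega> > 0" and nonneg: "AE t in m. 0 \<le> t" "\<And>t. 0 \<le> u t"
    and meas: "(\<lambda>t. t) \<in> borel_measurable m"
    and int: "\<And>k. integrable m (\<lambda>t. t ^ (2 * k) * u t)"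
    and bound: "\<And>k. (\<integral>t. t ^ (2 * k) * u t \<partial>m) \<le> \<omega> ^ (2 * k) * M"
  shows "AE t in m. t > \<omega> \<longrightarrow> u t = 0"
proof -
  have "AE t in m. c \<le> t \<longrightarrow> u t = 0" if "c > \<omega>" for c
  proof -
    define v where "v t = indicator {t \<in> space m. c \<le> t} t * u t" for t
    have set: "{t \<in> space m. c \<le> t} \<in> sets m"
      using meas by measurable
    have "integrable m u"
      using int[of 0] by simp
    from integrable_mult_indicator[OF set this] have v: "integrable m v"
      unfolding v_def real_scaleR_def .
    have "(\<integral>t. v t \<partial>m) \<le> ((\<omega> / c)\<^sup>2) ^ k * M" for k
    proof -
      \<comment> \<open>A Chebyshev estimate: on \<open>[c, \<infinity>)\<close> the weight
        \<open>t ^ (2 * k)\<close> is at least \<open>c ^ (2 * k)\<close>, and elsewhere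
        \<open>v\<close> is 0.\<close>
      have "c ^ (2 * k) * (\<integral>t. v t \<partial>m) = (\<integral>t. c ^ (2 * k) * v t \<partial>m)"
        by simp
      also have "\<dots> \<le> (\<integral>t. t ^ (2 * k) * u t \<partial>m)"
      proof (rule integral_mono_AE)
        show "AE t in m. c ^ (2 * k) * v t \<le> t ^ (2 * k) * u t"
          using nonneg(1)
        proof eventually_elim
          case (elim t)
          have "c ^ (2 * k) \<le> t ^ (2 * k)" if "c \<le> t"
            using that \<open>\<omega> > 0\<close> \<open>c > \<omega>\<close> by (intro power_mono) auto
          then show ?case
            using elim nonneg(2)[of t] by (auto simp: v_def indicator_def intro: mult_right_mono)
        qed
      qed (use v int in auto)
      also have "\<dots> \<le> \<omega> ^ (2 * k) * M"
        by (rule bound)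
      finally have "(\<integral>t. v t \<partial>m) \<le> \<omega> ^ (2 * k) * M / c ^ (2 * k)"
        using \<open>\<omega> > 0\<close> \<open>c > \<omega>\<close> by (subst pos_le_divide_eq) (simp_all add: ac_simps)
      then show ?thesis
        by (simp only: power_mult[symmetric] power_divide times_divide_eq_left)
    qed
    moreover have "(\<lambda>k. ((\<omega> / c)\<^sup>2) ^ k * M) \<longlonglongrightarrow> 0"
      using \<open>\<omega> > 0\<close> \<open>c > \<omega>\<close>
      by (intro tendsto_mult_left_zero LIMSEQ_power_zero) (simp add: abs_square_less_1)
    \<comment> \<open>The left side does not depend on \<open>k\<close>, so it is at most the limit
      of the bounds.\<close>
    ultimately have "(\<integral>t. v t \<partial>m) \<le> 0"
      by (rule LIMSEQ_le_const[rotated, OF exI, OF allI, OF impI])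
    moreover have v0: "0 \<le> v t" for t
      using nonneg(2)[of t] by (simp add: v_def)
    ultimately have "(\<integral>t. v t \<partial>m) = 0"
      by (simp add: antisym)
    then have "AE t in m. v t = 0"
      using integral_nonneg_eq_0_iff_AE[OF v] v0 by simp
    with AE_space show ?thesis
      by eventually_elim (auto simp: v_def indicator_def split: if_splits)
  qed
  \<comment> \<open>The exceptional null set depends on \<open>c\<close>, so only countably many
    thresholds may be combined; those chosen decrease to \<open>\<omega>\<close>.\<close>
  then have "AE t in m. \<forall>n::nat. \<omega> + 1 / Suc n \<le> t \<longrightarrow> u t = 0"
    by (subst AE_all_countable) simp
  then show ?thesis
  proof eventually_elim
    case (elim t)
    show ?case
    proof
      assume "t > \<omega>"
      then obtain n where "1 / real (Suc n) < t - \<omega>"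
        using nat_approx_posE[of "t - \<omega>"] by auto
      then have "\<omega> + 1 / Suc n \<le> t"
        by linarith
      with elim show "u t = 0"
        by blast
    qed
  qed
qed

text \<open>The identity is measurable for the Borel sets of \<open>[0, \<infinity>)\<close>, and a
  larger sigma-algebra on the same space keeps it so.\<close>

lemma spectral_representation_borel_measurable:
  assumes "spectral_representation A D m X \<Gamma> F"
  shows "(\<lambda>t. t) \<in> borel_measurable m"
proof -
  have space: "space m = {0..}" and sub: "sets (restrict_space borel {0..}) \<subseteq> sets m"
    using assms unfolding spectral_representation_def by blast+
  have "(\<lambda>t::real. t) \<in> borel_measurable (restrict_space borel {0..})"
    by (simp add: measurable_restrict_space1)
  then show ?thesis
    using space sub by (auto simp: measurable_def)
qed

section \<open>Moments of \<open>F f\<close> and the two implications\<close>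

lemma norm_power_scaleR_squared:
  "(norm (t ^ k *\<^sub>R x))\<^sup>2 = t ^ (2 * k) * (norm x)\<^sup>2"
  by (simp add: power_mult_distrib power_mult power2_eq_square flip: power_mult_distrib)

text \<open>The isometry is applied to \<open>(D ^^ k) f\<close>, whose transform is
  \<open>t ^ k *\<^sub>R F f t\<close> almost everywhere.\<close>

lemma spectral_representation_power:
  assumes rep: "spectral_representation A D m X \<Gamma> F" and f: "f \<in> power_domain A D k"
  shows "integrable m (\<lambda>t. t ^ (2 * k) * (norm (F f t))\<^sup>2)"
    and "(\<integral>t. t ^ (2 * k) * (norm (F f t))\<^sup>2 \<partial>m) = (norm ((D ^^ k) f))\<^sup>2"
proof -
  have "F f \<in> direct_integral_power m \<Gamma> k"
    using assms unfolding spectral_representation_def by blast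
  then show int: "integrable m (\<lambda>t. t ^ (2 * k) * (norm (F f t))\<^sup>2)"
    unfolding direct_integral_power_def direct_integral_def by (simp only: mem_Collect_eq norm_power_scaleR_squared)
  have "direct_integral_norm m (F ((D ^^ k) f)) = norm ((D ^^ k) f)"
    and "F ((D ^^ k) f) \<in> direct_integral m \<Gamma>"
    using rep unfolding spectral_representation_def unitary_onto_direct_integral_def by blast+
  then have norm: "(norm ((D ^^ k) f))\<^sup>2 = (\<integral>t. (norm (F ((D ^^ k) f) t))\<^sup>2 \<partial>m)"
    and int': "integrable m (\<lambda>t. (norm (F ((D ^^ k) f) t))\<^sup>2)"
    by (auto simp: direct_integral_norm_def direct_integral_def real_sqrt_pow2
        dest!: sym[of "sqrt _"])
  have "AE t in m. F ((D ^^ k) f) t = t ^ k *\<^sub>R F f t"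
    using assms unfolding spectral_representation_def by blast
  then have "AE t in m. t ^ (2 * k) * (norm (F f t))\<^sup>2 = (norm (F ((D ^^ k) f) t))\<^sup>2"
    by eventually_elim (simp only: norm_power_scaleR_squared)
  then show "(\<integral>t. t ^ (2 * k) * (norm (F f t))\<^sup>2 \<partial>m) = (norm ((D ^^ k) f))\<^sup>2"
    unfolding norm using int int' by (intro integral_cong_AE) auto
qed

lemma paley_wiener_bernstein:
  assumes rep: "spectral_representation A D m X \<Gamma> F"
    and f: "f \<in> paley_wiener m F \<omega>" and "\<omega> > 0"
  shows "f \<in> power_domain A D k" and "norm ((D ^^ k) f) \<le> \<omega> ^ k * norm f"
proof -
  have space: "space m = {0..}" and field: "measurable_field m X \<Gamma>"
    and unit: "unitary_onto_direct_integral m \<Gamma> F"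
    using rep unfolding spectral_representation_def by blast+
  have Ff: "F f \<in> direct_integral m \<Gamma>"
    using unit unfolding unitary_onto_direct_integral_def by blast
  have meas: "(\<lambda>t. t) \<in> borel_measurable m"
    by (rule spectral_representation_borel_measurable[OF rep])
  have "AE t in m. t > \<omega> \<longrightarrow> F f t = 0"
    using f by (simp add: paley_wiener_def)
  \<comment> \<open>\<open>AE_space\<close> supplies \<open>0 \<le> t\<close>, without which
    \<open>t \<le> \<omega>\<close> would not pass to powers.\<close>
  with AE_space have le: "AE t in m. t ^ (2 * k) * (norm (F f t))\<^sup>2 \<le> \<omega> ^ (2 * k) * (norm (F f t))\<^sup>2"
  proof eventually_elim
    case (elim t)
    show ?case
    proof (cases "t > \<omega>")
      case False
      then show ?thesis
        using elim space by (intro mult_right_mono power_mono) auto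
    qed (use elim in simp)
  qed
  have int0: "integrable m (\<lambda>t. \<omega> ^ (2 * k) * (norm (F f t))\<^sup>2)"
    and Ff\<Gamma>: "F f \<in> \<Gamma>"
    using Ff by (auto simp: direct_integral_def)
  have pow: "(\<lambda>t. t ^ k *\<^sub>R F f t) \<in> \<Gamma>"
    using meas by (intro measurable_field_scaleR[OF field Ff\<Gamma>]) measurable
  then have "(\<lambda>t. norm (t ^ k *\<^sub>R F f t)) \<in> borel_measurable m"
    by (rule measurable_fieldD(5)[OF field])
  then have "(\<lambda>t. (norm (t ^ k *\<^sub>R F f t))\<^sup>2) \<in> borel_measurable m"
    by measurable
  then have "integrable m (\<lambda>t. (norm (t ^ k *\<^sub>R F f t))\<^sup>2)"
  proof (rule Bochner_Integration.integrable_bound[OF int0])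
    show "AE t in m. norm ((norm (t ^ k *\<^sub>R F f t))\<^sup>2) \<le> norm (\<omega> ^ (2 * k) * (norm (F f t))\<^sup>2)"
      using le by eventually_elim (simp add: norm_power_scaleR_squared del: norm_scaleR)
  qed
  then have "F f \<in> direct_integral_power m \<Gamma> k"
    using Ff pow by (simp add: direct_integral_power_def direct_integral_def)
  \<comment> \<open>The representation yields only some \<open>g\<close> in the domain of the power
    with the same transform; injectivity gives \<open>g = f\<close>.\<close>
  then obtain g where "g \<in> power_domain A D k" and "AE t in m. F g t = F f t"
    using rep unfolding spectral_representation_def by blast
  with unitary_onto_direct_integral_eqI[OF unit] show dom: "f \<in> power_domain A D k"
    by blast
  have "(norm ((D ^^ k) f))\<^sup>2 = (\<integral>t. t ^ (2 * k) * (norm (F f t))\<^sup>2 \<partial>m)"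
    by (rule spectral_representation_power(2)[OF rep dom, symmetric])
  also have "\<dots> \<le> (\<integral>t. \<omega> ^ (2 * k) * (norm (F f t))\<^sup>2 \<partial>m)"
    by (rule integral_mono_AE[OF spectral_representation_power(1)[OF rep dom] int0 le])
  \<comment> \<open>The case \<open>k = 0\<close> of the moment formula is the isometry for
    \<open>f\<close> itself.\<close>
  also have "\<dots> = (\<omega> ^ k * norm f)\<^sup>2"
    using spectral_representation_power(2)[OF rep, of f 0]
    by (simp add: power_mult_distrib mult.commute flip: power_mult)
  finally show "norm ((D ^^ k) f) \<le> \<omega> ^ k * norm f"
    by (rule power2_le_imp_le) (use \<open>\<omega> > 0\<close> in simp)
qed

lemma bernstein_paley_wiener:
  assumes rep: "spectral_representation A D m X \<Gamma> F" and "\<omega> > 0"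
    and dom: "\<And>k. f \<in> power_domain A D k"
    and bernstein: "\<And>k. norm ((D ^^ k) f) \<le> \<omega> ^ k * norm f"
  shows "f \<in> paley_wiener m F \<omega>"
proof -
  have space: "space m = {0..}"
    using rep unfolding spectral_representation_def by blast
  \<comment> \<open>The squared Bernstein inequality is the moment bound for
    \<open>u t = (norm (F f t))\<^sup>2\<close> and \<open>M = (norm f)\<^sup>2\<close>.\<close>
  have "(\<integral>t. t ^ (2 * k) * (norm (F f t))\<^sup>2 \<partial>m) \<le> \<omega> ^ (2 * k) * (norm f)\<^sup>2" for k
    using power_mono[OF bernstein[of k], of 2] spectral_representation_power(2)[OF rep dom[of k]]
    by (simp add: power_mult_distrib mult.commute flip: power_mult)
  then have "AE t in m. t > \<omega> \<longrightarrow> (norm (F f t))\<^sup>2 = 0"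
    using spectral_representation_power(1)[OF rep dom] AE_space[of m] space \<open>\<omega> > 0\<close>
      spectral_representation_borel_measurable[OF rep]
    by (intro AE_zero_of_moment_bound) auto
  then show ?thesis
    by (simp add: paley_wiener_def)
qed

theorem theorem1:
  fixes A :: "'e::complex_hilbert set" and D :: "'e \<Rightarrow> 'e"
    and m :: "real measure" and X :: "real \<Rightarrow> 'h::complex_hilbert set"
    and \<Gamma> :: "(real \<Rightarrow> 'h) set" and F :: "'e \<Rightarrow> real \<Rightarrow> 'h"
    and \<omega> :: real and f :: 'e
  assumes "self_adjoint A D" and "positive_operator A D"
    and "spectral_representation A D m X \<Gamma> F"
    and "\<omega> > 0"
  shows "f \<in> paley_wiener m F \<omega> \<longleftrightarrow>
    (\<forall>k::nat. f \<in> power_domain A D k \<and> norm ((D ^^ k) f) \<le> \<omega> ^ k * norm f)"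
  using paley_wiener_bernstein[OF assms(3) _ assms(4)] bernstein_paley_wiener[OF assms(3,4)]
  by blast

end
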